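(* Let $\ell$ be a line of $\mathrm{PG}_q(\mathbb{F}_{q^t})$ with $o(\ell)=m$. Let $\nu,h\in\{1,2,\ldots,t-1\}$ with $\gcd(\nu,t)=1$. Suppose that $m$ does not divide $h$, and let $n$ be the integer with $1\le n\le m-1$ and $n\equiv h\nu^{-1}\pmod m$, where $\nu^{-1}$ is the inverse of $\nu$ modulo $m$. Let $d=\theta_{\nu-1}^{-1}\theta_{h-1}$, where $\theta_{\nu-1}^{-1}$ is the inverse of $\theta_{\nu-1}$ modulo $\theta_{t-1}$. If $q\ge n$, then $\ell^d$ is a normal rational curve of order $n$ in some $n$-dimensional subspace of $\mathrm{PG}_q(\mathbb{F}_{q^t})$.
   Context: $\theta_s=(q^{s+1}-1)/(q-1)$. $\mathrm{PG}_q(\mathbb{F}_{q^t})\cong\mathrm{PG}(t-1,q)$ has as points $\langle x\rangle_q=\mathbb{F}_qx$, $x\in\mathbb{F}_{q^t}^*$. For a line $\ell$ with underlying two-dimensional $\mathbb{F}_q$-subspace $\hat\ell$, $o(\ell)$ is the smallest positive integer $m$ such that $\hat\ell$ lies in a one-dimensional $\mathbb{F}_{q^m}$-subspace of $\mathbb{F}_{q^t}$ ($\mathbb{F}_{q^m}$ a subfield; thus $m\mid t$). $\ell^d=\{\langle x^d\rangle_q:\langle x\rangle_q\in\ell\}$ (well defined for $d$ taken modulo $\theta_{t-1}$ since $x^{\theta_{t-1}}\in\mathbb{F}_q^*$). A normal rational curve of order $n$ in an $n$-subspace $\mathcal{B}$ is the image under a projectivity $\mathrm{PG}(n,q)\to\mathcal{B}$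 of $\{\langle(1,\lambda,\ldots,\lambda^n)\rangle:\lambda\in\mathbb{F}_q\}\cup\{\langle(0,\ldots,0,1)\rangle\}$. *)

theory Defs
  imports
    Complex_Main
    "HOL-Library.Cardinality"
    "HOL-Library.Function_Algebras"
    "HOL-Number_Theory.Cong"
begin

section \<open>Projective geometry of a vector space\<close>

text \<open>
  A vector space is given by its scalar multiplication \<open>s\<close>, as in the library. Points are
  one-dimensional linear subspaces (so they contain \<open>0\<close>), and a projective subspace is identified
  with the set of its points. The underlying linear subspace of a nonempty projective subspace
  \<open>S\<close> is therefore \<open>\<Union>S\<close>.
\<close>

definition pg_point :: "('k::field \<Rightarrow> 'v::ab_group_add \<Rightarrow> 'v) \<Rightarrow> 'v \<Rightarrow> 'v set" where
  "pg_point s x = module.span s {x}"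

definition pg_points :: "('k::field \<Rightarrow> 'v::ab_group_add \<Rightarrow> 'v) \<Rightarrow> 'v set \<Rightarrow> 'v set set" where
  "pg_points s V = {pg_point s x | x. x \<in> V \<and> x \<noteq> 0}"

definition pg_subspace ::
    "('k::field \<Rightarrow> 'v::ab_group_add \<Rightarrow> 'v) \<Rightarrow> nat \<Rightarrow> 'v set set \<Rightarrow> bool" where
  "pg_subspace s n S \<longleftrightarrow>
     (\<exists>V. module.subspace s V \<and> vector_space.dim s V = n + 1 \<and> S = pg_points s V)"

definition pg_line :: "('k::field \<Rightarrow> 'v::ab_group_add \<Rightarrow> 'v) \<Rightarrow> 'v set set \<Rightarrow> bool" where
  "pg_line s l \<longleftrightarrow> pg_subspace s 1 l"

text \<open>
  The map of points \<open>\<phi>\<close> is induced by an isomorphism between the underlying linear subspaces. That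
  isomorphism is given as the restriction of a linear map of the ambient spaces; this is no loss,
  because a linear map on a subspace extends to the whole space.
\<close>

definition projectivity ::
    "('k::field \<Rightarrow> 'v::ab_group_add \<Rightarrow> 'v) \<Rightarrow> 'v set set \<Rightarrow>
     ('k \<Rightarrow> 'w::ab_group_add \<Rightarrow> 'w) \<Rightarrow> 'w set set \<Rightarrow> ('v set \<Rightarrow> 'w set) \<Rightarrow> bool" where
  "projectivity s1 S1 s2 S2 \<phi> \<longleftrightarrow>
     (\<exists>f. Vector_Spaces.linear s1 s2 f \<and> bij_betw f (\<Union>S1) (\<Union>S2) \<and>
          (\<forall>x \<in> \<Union>S1. x \<noteq> 0 \<longrightarrow> \<phi> (pg_point s1 x) = pg_point s2 (f x)))"


section \<open>Normal rational curves\<close>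

text \<open>
  The space of coordinate vectors \<open>(v 0, \<dots>, v n)\<close> over \<open>'k\<close> is realised inside \<open>nat \<Rightarrow> 'k\<close> as the
  sequences vanishing beyond index \<open>n\<close>.
\<close>

definition coord_scale :: "'k::field \<Rightarrow> (nat \<Rightarrow> 'k) \<Rightarrow> (nat \<Rightarrow> 'k)" where
  "coord_scale c v = (\<lambda>i. c * v i)"

definition coord_space :: "nat \<Rightarrow> (nat \<Rightarrow> 'k::field) set" where
  "coord_space n = {v. \<forall>i>n. v i = 0}"

definition PG :: "nat \<Rightarrow> (nat \<Rightarrow> 'k::field) set set" where
  "PG n = pg_points coord_scale (coord_space n)"

definition standard_nrc :: "nat \<Rightarrow> (nat \<Rightarrow> 'k::field) set set" where
  "standard_nrc n =
     {pg_point coord_scale (\<lambda>i. if i \<le> n then c ^ i else 0) | c. True} \<union>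
     {pg_point coord_scale (\<lambda>i. if i = n then 1 else 0)}"

definition normal_rational_curve ::
    "('k::field \<Rightarrow> 'v::ab_group_add \<Rightarrow> 'v) \<Rightarrow> nat \<Rightarrow> 'v set set \<Rightarrow> 'v set set \<Rightarrow> bool" where
  "normal_rational_curve s n B C \<longleftrightarrow>
     pg_subspace s n B \<and> (\<exists>\<phi>. projectivity coord_scale (PG n) s B \<phi> \<and> C = \<phi> ` standard_nrc n)"


section \<open>Finite field extensions\<close>

text \<open>
  The extension is given by an embedding \<open>\<iota>\<close> of the small field \<open>'k\<close> into the large field \<open>'a\<close>,
  which makes \<open>'a\<close> a vector space over \<open>'k\<close>.
\<close>

definition field_embedding :: "('k::field \<Rightarrow> 'a::field) \<Rightarrow> bool" where
  "field_embedding \<iota> \<longleftrightarrow>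
     \<iota> 1 = 1 \<and> (\<forall>x y. \<iota> (x + y) = \<iota> x + \<iota> y) \<and> (\<forall>x y. \<iota> (x * y) = \<iota> x * \<iota> y)"

definition ext_scale :: "('k::field \<Rightarrow> 'a::field) \<Rightarrow> 'k \<Rightarrow> 'a \<Rightarrow> 'a" where
  "ext_scale \<iota> c x = \<iota> c * x"

definition is_subfield :: "'a::field set \<Rightarrow> bool" where
  "is_subfield L \<longleftrightarrow> 0 \<in> L \<and> 1 \<in> L \<and>
     (\<forall>x\<in>L. \<forall>y\<in>L. x - y \<in> L \<and> x * y \<in> L) \<and> (\<forall>x\<in>L. inverse x \<in> L)"

text \<open>
  In \<open>line_order\<close>, the first argument is the order \<open>q\<close> of the ground field. The set \<open>L\<close> is the
  subfield of order \<open>q ^ m\<close>, and the multiples of a nonzero \<open>a\<close> by \<open>L\<close> form a one-dimensional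
  \<open>L\<close>-subspace. The set of such \<open>m\<close> contains the degree of \<open>'a\<close> over the ground field, so that
  the least element exists.
\<close>

definition line_order :: "nat \<Rightarrow> 'a::field set set \<Rightarrow> nat" where
  "line_order q l =
     (LEAST m. m > 0 \<and>
        (\<exists>L. is_subfield L \<and> card L = q ^ m \<and> (\<exists>a. a \<noteq> 0 \<and> \<Union>l \<subseteq> {c * a | c. c \<in> L})))"

definition power_image ::
    "('k::field \<Rightarrow> 'a::field \<Rightarrow> 'a) \<Rightarrow> nat \<Rightarrow> 'a set set \<Rightarrow> 'a set set" where
  "power_image s d l = {pg_point s (x ^ d) | x. x \<noteq> 0 \<and> pg_point s x \<in> l}"

text \<open>For \<open>q \<ge> 2\<close> the division is exact.\<close>

definition theta :: "nat \<Rightarrow> nat \<Rightarrow> nat" where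
  "theta q s = (q ^ (s + 1) - 1) div (q - 1)"


section \<open>Well-definedness\<close>

lemma vector_space_coord_scale: "vector_space (coord_scale :: 'k::field \<Rightarrow> _)"
  by unfold_locales (auto simp: coord_scale_def algebra_simps)

lemma vector_space_ext_scale: "field_embedding \<iota> \<Longrightarrow> vector_space (ext_scale \<iota>)"
  by unfold_locales (auto simp: ext_scale_def field_embedding_def algebra_simps)

lemma Union_pg_points:
  assumes "vector_space s" "module.subspace s V" "V \<noteq> {0}"
  shows "\<Union>(pg_points s V) = V"
proof -
  interpret vector_space s by fact
  show ?thesis
  proof (intro equalityI subsetI)
    fix y assume "y \<in> \<Union>(pg_points s V)"
    then obtain x where "x \<in> V" "y \<in> span {x}"
      by (auto simp: pg_points_def pg_point_def)
    then show "y \<in> V"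
      using assms(2) span_minimal[of "{x}" V] by auto
  next
    fix y assume y: "y \<in> V"
    obtain z where z: "z \<in> V" "z \<noteq> 0"
      using assms(2,3) subspace_0 by blast
    show "y \<in> \<Union>(pg_points s V)"
    proof (cases "y = 0")
      case True
      then show ?thesis
        using z span_zero[of "{z}"] by (auto simp: pg_points_def pg_point_def)
    next
      case False
      then show ?thesis
        using y span_base[of y "{y}"] by (auto simp: pg_points_def pg_point_def)
    qed
  qed
qed

lemma theta_eq_sum:
  assumes "q \<ge> 2"
  shows "theta q s = (\<Sum>i\<le>s. q ^ i)"
proof -
  have "q ^ (s + 1) - 1 = (q - 1) * (\<Sum>i\<le>s. q ^ i)"
  proof (induction s)
    case (Suc s)
    have "q ^ (s + 1) \<ge> 1" using assms by simp
    moreover have "(q - 1) * q ^ Suc s = q ^ (Suc s + 1) - q ^ (s + 1)"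
      by (simp add: algebra_simps)
    moreover have "q ^ (s + 1) \<le> q ^ (Suc s + 1)"
      using assms by (intro power_increasing) auto
    ultimately show ?case
      using Suc by (simp add: distrib_left del: power_Suc)
  qed simp
  then show ?thesis using assms by (simp add: theta_def)
qed

text \<open>The inverse of \<open>theta q (\<nu> - 1)\<close> modulo \<open>theta q (t - 1)\<close> exists if \<open>gcd \<nu> t = 1\<close>.\<close>

lemma coprime_sum_powers:
  fixes q :: nat
  assumes "coprime a b"
  shows "coprime (\<Sum>i<a. q ^ i) (\<Sum>i<b. q ^ i)"
  using assms
proof (induction "a + b" arbitrary: a b rule: less_induct)
  case less
  have step: "coprime (\<Sum>i<a. q ^ i) (\<Sum>i<b. q ^ i)"
    if a0: "0 < a" and ab: "a \<le> b" "coprime a b"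
      and IH: "\<And>x y. x + y < a + b \<Longrightarrow> coprime x y \<Longrightarrow> coprime (\<Sum>i<x. q ^ i) (\<Sum>i<y. q ^ i)"
    for a b
  proof -
    have "coprime a (b - a)"
      using gcd_diff1_nat[OF ab(1)] ab(2)
      by (simp only: coprime_iff_gcd_eq_1 gcd.commute[of a])
    then have *: "coprime (\<Sum>i<a. q ^ i) (\<Sum>i<b - a. q ^ i)"
      using a0 ab(1) by (intro IH) auto
    have "(\<Sum>i<a + c. q ^ i) = (\<Sum>i<a. q ^ i) + q ^ a * (\<Sum>i<c. q ^ i)" for c
      by (induction c) (auto simp: algebra_simps power_add)
    from this[of "b - a"] ab(1)
    have split: "(\<Sum>i<b. q ^ i) = (\<Sum>i<a. q ^ i) + q ^ a * (\<Sum>i<b - a. q ^ i)" by simp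
    have "coprime (\<Sum>i<a. q ^ i) (q ^ a)"
    proof -
      obtain a' where a': "a = Suc a'" using a0 by (cases a) auto
      have "(\<Sum>i<a. q ^ i) = 1 + q * (\<Sum>i<a'. q ^ i)"
        unfolding a' sum.lessThan_Suc_shift by (simp add: sum_distrib_left)
      moreover have "coprime (1 + q * x) q" for x :: nat
      proof (rule coprimeI)
        fix c assume "c dvd 1 + q * x" "c dvd q"
        then show "is_unit c"
          using dvd_add_left_iff[of c "q * x" 1] dvd_mult2[of c q x] by simp
      qed
      ultimately show ?thesis by (metis coprime_power_right_iff)
    qed
    then have "coprime (\<Sum>i<a. q ^ i) (q ^ a * (\<Sum>i<b - a. q ^ i))"
      using * by (simp only: coprime_mult_right_iff)
    moreover have "coprime x (x + y)" if "coprime x y" for x y :: nat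
    proof (rule coprimeI)
      fix c assume "c dvd x" "c dvd x + y"
      then show "is_unit c"
        using dvd_add_right_iff[of c x y] coprime_common_divisor[OF that] by simp
    qed
    ultimately show ?thesis by (simp only: split)
  qed
  note IH = less.hyps
  consider "a = 0" | "b = 0" | "0 < a" "a \<le> b" | "0 < b" "b \<le> a" by linarith
  then show ?case
  proof cases
    case 1
    then show ?thesis using less.prems by simp
  next
    case 2
    then show ?thesis using less.prems by simp
  next
    case 3
    then show ?thesis using less.prems IH by (rule step)
  next
    case 4
    have "coprime (\<Sum>i<b. q ^ i) (\<Sum>i<a. q ^ i)"
    proof (rule step[OF 4])
      show "coprime b a" using less.prems by (simp only: coprime_commute)
    next
      fix x y :: nat
      assume "x + y < b + a" "coprime x y"
      then show "coprime (\<Sum>i<x. q ^ i) (\<Sum>i<y. q ^ i)"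
        by (intro IH) (simp_all only: add.commute)
    qed
    then show ?thesis by (simp only: coprime_commute)
  qed
qed

lemma theta_inverse_exists:
  assumes "q \<ge> 2" "\<nu> \<ge> 1" "t \<ge> 1" "gcd \<nu> t = 1"
  shows "\<exists>e. [e * theta q (\<nu> - 1) = 1] (mod theta q (t - 1))"
proof -
  have "theta q (k - 1) = (\<Sum>i<k. q ^ i)" if "k \<ge> 1" for k
    using that assms(1) by (cases k) (auto simp: theta_eq_sum lessThan_Suc_atMost)
  then have "coprime (theta q (\<nu> - 1)) (theta q (t - 1))"
    using assms coprime_sum_powers[of \<nu> t q] by (simp add: coprime_iff_gcd_eq_1)
  then show ?thesis
    by (metis cong_solve_coprime_nat mult.commute One_nat_def)
qed

end

theory Submission
  imports
    Defs
    "HOL-Computational_Algebra.Polynomial"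
    "HOL-Library.FuncSet"
begin

text \<open>
  Up to a scalar factor the line consists of the points \<open>\<langle>c - w\<rangle>\<close> and \<open>\<langle>1\<rangle>\<close>, where \<open>w\<close> lies in the field
  of order \<open>q ^ m\<close>. On that field \<open>z ^ d\<close> agrees up to ground field factors with
  \<open>z ^ (\<Sum>i<n. q ^ (\<nu> * i))\<close>, so that \<open>(c - w) ^ d\<close> becomes the value at \<open>c\<close> of the monic polynomial
  \<open>P = \<Prod>i<n. X - w ^ q ^ (\<nu> * i)\<close> of degree \<open>n\<close>. Hence the power of the line is the image of the
  standard normal rational curve under the linear map sending the unit vectors to the coefficients of
  \<open>P\<close>. These are linearly independent over the ground field: a linear relation also holds for all
  conjugates of \<open>P\<close> under \<open>z \<mapsto> z ^ q ^ \<nu>\<close>, and successive differences of conjugates yield monic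
  polynomials of every degree up to \<open>n\<close> which satisfy it.
\<close>

section \<open>Sums of powers\<close>

lemma sum_powers_add:
  fixes q :: "'a::comm_semiring_1"
  shows "(\<Sum>i<a + b. q ^ i) = (\<Sum>i<a. q ^ i) + q ^ a * (\<Sum>i<b. q ^ i)"
  by (induction b) (auto simp: algebra_simps power_add)

text \<open>Cuts the \<open>a * b\<close> terms into \<open>b\<close> blocks of length
  \<open>a\<close>. With \<open>a = \<nu>\<close> and \<open>b = n\<close> the second factor is the
  exponent that replaces \<open>d\<close>.\<close>

lemma sum_powers_mult:
  fixes q :: "'a::comm_semiring_1"
  shows "(\<Sum>i<a * b. q ^ i) = (\<Sum>i<a. q ^ i) * (\<Sum>i<b. q ^ (a * i))"
proof (induction b)
  case (Suc b)
  have "(\<Sum>i<a * Suc b. q ^ i) = (\<Sum>i<a * b + a. q ^ i)"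
    by (simp add: add.commute)
  also have "\<dots> = (\<Sum>i<a. q ^ i) * (\<Sum>i<Suc b. q ^ (a * i))"
    by (simp only: sum_powers_add Suc.IH sum.lessThan_Suc) (simp add: algebra_simps)
  finally show ?case .
qed simp

text \<open>\<open>m * k\<close> further terms contribute \<open>q ^ a\<close> times a sum of that
  length, which has the sum of length \<open>m\<close> as a factor.\<close>

lemma cong_sum_powers:
  fixes q :: nat
  assumes "[a = b] (mod m)"
  shows "[(\<Sum>i<a. q ^ i) = (\<Sum>i<b. q ^ i)] (mod (\<Sum>i<m. q ^ i))"
proof -
  have *: "[(\<Sum>i<a + m * k. q ^ i) = (\<Sum>i<a. q ^ i)] (mod (\<Sum>i<m. q ^ i))" for a k
  proof -
    have "(\<Sum>i<a + m * k. q ^ i) = (\<Sum>i<a. q ^ i) + (\<Sum>i<m. q ^ i) * (q ^ a * (\<Sum>i<k. q ^ (m * i)))"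
      by (simp add: sum_powers_add sum_powers_mult)
    then show ?thesis by (simp only: cong_def mod_mult_self2)
  qed
  have le: "[(\<Sum>i<a. q ^ i) = (\<Sum>i<b. q ^ i)] (mod (\<Sum>i<m. q ^ i))"
    if le: "a \<le> b" and cong: "[a = b] (mod m)" for a b
  proof -
    obtain k where "b = a + m * k"
      using cong_le_nat[OF le, of m] cong by (auto simp: cong_sym_eq mult.commute add.commute)
    then show ?thesis using *[of a k] by (simp add: cong_sym_eq)
  qed
  show ?thesis
    using le[of a b] le[of b a] assms by (cases "a \<le> b") (auto simp: cong_sym_eq)
qed

lemma theta_eq_sum_lessThan:
  assumes "q \<ge> 2" "k \<ge> 1"
  shows "theta q (k - 1) = (\<Sum>i<k. q ^ i)"
  using assms by (cases k) (auto simp: theta_eq_sum lessThan_Suc_atMost)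

section \<open>Products of consecutive linear factors\<close>

text \<open>Coefficients are integer polynomial expressions in the roots, so a ring homomorphism may
  be applied to either. It will be a power of Frobenius.\<close>

lemma coeff_linear_factors_hom:
  fixes w :: "nat \<Rightarrow> 'a::comm_ring_1" and g :: "'a \<Rightarrow> 'b::comm_ring_1"
  assumes add: "\<And>x y. g (x + y) = g x + g y" and mult: "\<And>x y. g (x * y) = g x * g y"
    and one: "g 1 = 1"
  shows "coeff (\<Prod>i<n. [:- g (w i), 1:]) k = g (coeff (\<Prod>i<n. [:- w i, 1:]) k)"
proof (induction n arbitrary: k)
  case 0
  have "g 0 = 0" using add[of 0 0] by simp
  then show ?case using one by (simp add: coeff_1)
next
  case (Suc n)
  have g0: "g 0 = 0" using add[of 0 0] by simp
  have "g (x - y) = g x - g y" for x y using add[of "x - y" y] by simp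
  moreover from this[of 0] have "g (- x) = - g x" for x using g0 by simp
  ultimately show ?case
    using g0 by (cases k) (simp_all add: Suc.IH add mult)
qed

lemma linear_factors_monic:
  fixes w :: "nat \<Rightarrow> 'a::idom"
  shows "degree (\<Prod>i<n. [:- w i, 1:]) = n" "coeff (\<Prod>i<n. [:- w i, 1:]) n = 1"
proof -
  show deg: "degree (\<Prod>i<n. [:- w i, 1:]) = n"
    by (subst degree_prod_eq_sum_degree) auto
  have "lead_coeff (\<Prod>i<n. [:- w i, 1:]) = 1"
    by (simp add: lead_coeff_prod)
  then show "coeff (\<Prod>i<n. [:- w i, 1:]) n = 1" by (simp only: deg)
qed

text \<open>
  Two neighbouring products of \<open>r + 1\<close> consecutive factors differ by a nonzero multiple of a product
  of \<open>r\<close> consecutive factors. A functional that kills all products of length \<open>n\<close> therefore kills a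
  monic polynomial of each degree at most \<open>n\<close>.
\<close>

lemma functional_vanishes_if_consecutive:
  fixes w c :: "nat \<Rightarrow> 'a::idom"
  assumes neq: "\<And>j r. 0 < r \<Longrightarrow> r \<le> n \<Longrightarrow> w (j + r) \<noteq> w j"
    and zero: "\<And>j. (\<Sum>k\<le>n. c k * coeff (\<Prod>i<n. [:- w (j + i), 1:]) k) = 0"
    and "r \<le> n"
  shows "c r = 0"
proof -
  define Q where "Q r j = (\<Prod>i<r. [:- w (j + i), 1:])" for r j
  define L where "L p = (\<Sum>k\<le>n. c k * coeff p k)" for p
  have L_diff: "L (p - p') = L p - L p'" for p p'
    by (simp add: L_def algebra_simps sum_subtractf)
  have L_smult: "L (smult a p) = a * L p" for a p
    by (simp add: L_def sum_distrib_left mult_ac)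
  \<comment> \<open>Downwards in \<open>r\<close>. The products starting at \<open>i\<close> and
    \<open>i + 1\<close> only yield the shorter one starting at \<open>i + 1\<close>, hence the
    offset \<open>n - r\<close>.\<close>
  have L0: "L (Q r (j + (n - r))) = 0" if "r \<le> n" for r j
    using that
  proof (induction r arbitrary: j rule: inc_induct)
    case base
    then show ?case using zero by (simp add: L_def Q_def)
  next
    case (step r)
    define i where "i = j + (n - Suc r)"
    have i: "j + (n - r) = Suc i" using step.hyps by (simp add: i_def)
    have "Q (Suc r) i = [:- w i, 1:] * Q r (Suc i)"
      by (simp only: Q_def prod.lessThan_Suc_shift) simp
    moreover have "Q (Suc r) (Suc i) = Q r (Suc i) * [:- w (i + Suc r), 1:]"
      by (simp add: Q_def)
    ultimately have "Q (Suc r) i - Q (Suc r) (Suc i) = smult (w (i + Suc r) - w i) (Q r (Suc i))"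
      by (simp add: algebra_simps smult_diff_left)
    moreover have "L (Q (Suc r) i) = 0" "L (Q (Suc r) (Suc i)) = 0"
      using step.IH[of j] step.IH[of "Suc j"] by (simp_all add: i_def)
    ultimately have "(w (i + Suc r) - w i) * L (Q r (Suc i)) = 0"
      by (metis L_diff L_smult diff_zero)
    then show ?case
      using neq[of "Suc r" i] step.hyps by (simp add: i)
  qed
  show ?thesis
    using \<open>r \<le> n\<close>
  proof (induction r rule: less_induct)
    case (less r)
    define p where "p = Q r (0 + (n - r))"
    have p: "degree p = r" "coeff p r = 1"
      unfolding p_def Q_def by (rule linear_factors_monic)+
    \<comment> \<open>Below \<open>r\<close> the values of \<open>c\<close> vanish by induction,
      above \<open>r\<close> the coefficients of \<open>p\<close> do.\<close>
    have "L p = (\<Sum>k\<le>n. if k = r then c r else 0)"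
      unfolding L_def
    proof (intro sum.cong refl)
      fix k assume "k \<in> {..n}"
      show "c k * coeff p k = (if k = r then c r else 0)"
        using less.IH[of k] less.prems p by (cases k r rule: linorder_cases) (auto simp: coeff_eq_0)
    qed
    then show ?case
      using L0[OF less.prems, of 0] less.prems by (simp add: p_def)
  qed
qed

section \<open>Finite fields and their subfields\<close>

text \<open>Multiplication by \<open>x \<noteq> 0\<close> permutes the nonzero elements of
  \<open>L\<close>. Comparing their products gives \<open>x ^ (card L - 1) = 1\<close>.\<close>

lemma subfield_power_card:
  fixes L :: "'a::field set"
  assumes L: "is_subfield L" "finite L" and x: "x \<in> L"
  shows "x ^ card L = x"
proof (cases "x = 0")
  case True
  have "0 < card L" using L x card_gt_0_iff by blast
  then show ?thesis using True by simp
next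
  case False
  have bij: "bij_betw ((*) x) (L - {0}) (L - {0})"
  proof (rule bij_betw_byWitness[where f' = "(*) (inverse x)"])
    show "(*) x ` (L - {0}) \<subseteq> L - {0}" "(*) (inverse x) ` (L - {0}) \<subseteq> L - {0}"
      using L x False by (auto simp: is_subfield_def)
  qed (use False in auto)
  have "\<Prod>(L - {0}) = (\<Prod>y\<in>L - {0}. x * y)"
    using prod.reindex_bij_betw[OF bij, of "\<lambda>y. y"] by simp
  also have "\<dots> = x ^ card (L - {0}) * \<Prod>(L - {0})"
    by (simp add: prod.distrib)
  finally have "x ^ card (L - {0}) = 1"
    using L by simp
  moreover have "card L = Suc (card (L - {0}))"
    using L card_Suc_Diff1[of L 0] by (simp add: is_subfield_def del: card_Diff_insert)
  ultimately show ?thesis by simp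
qed

lemma finite_field_power_CARD:
  fixes x :: "'a::{field,finite}"
  shows "x ^ CARD('a) = x"
  by (rule subfield_power_card) (auto simp: is_subfield_def)

text \<open>A vector \<open>b\<close> outside the span multiplies its size by
  \<open>CARD('k)\<close>: each new element is \<open>s k b + v\<close> for exactly one
  pair.\<close>

lemma card_span_independent:
  fixes s :: "'k::{field,finite} \<Rightarrow> 'v::ab_group_add \<Rightarrow> 'v"
  assumes "vector_space s" "finite B" "\<not> module.dependent s B"
  shows "card (module.span s B) = CARD('k) ^ card B"
proof -
  interpret vector_space s by fact
  show ?thesis
    using assms(2,3)
  proof (induction B)
    case (insert b B)
    from insert have indep: "independent B" and b: "b \<notin> span B"
      by (auto simp: independent_insert)
    have "inj_on (\<lambda>(k, v). s k b + v) (UNIV \<times> span B)"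
    proof (rule inj_onI, clarify)
      fix k v k' v'
      assume v: "v \<in> span B" "v' \<in> span B" and eq: "s k b + v = s k' b + v'"
      then have *: "s (k - k') b = v' - v" by (simp add: scale_left_diff_distrib algebra_simps)
      have "k = k'"
      proof (rule ccontr)
        assume "k \<noteq> k'"
        then have "b = s (inverse (k - k')) (s (k - k') b)" by simp
        then have "b \<in> span B" unfolding * using v by (metis span_diff span_scale)
        with b show False by simp
      qed
      with eq show "k = k' \<and> v = v'" by simp
    qed
    moreover have "span (insert b B) = (\<lambda>(k, v). s k b + v) ` (UNIV \<times> span B)"
    proof (intro equalityI subsetI)
      fix x assume "x \<in> span (insert b B)"
      then obtain k where "x - s k b \<in> span B" by (auto simp: span_breakdown_eq)
      then show "x \<in> (\<lambda>(k, v). s k b + v) ` (UNIV \<times> span B)"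
        by (intro image_eqI[of _ _ "(k, x - s k b)"]) auto
    next
      fix x assume "x \<in> (\<lambda>(k, v). s k b + v) ` (UNIV \<times> span B)"
      then obtain k v where "x = s k b + v" "v \<in> span B" by auto
      then show "x \<in> span (insert b B)"
        unfolding span_breakdown_eq by (intro exI[of _ k]) simp
    qed
    ultimately show ?case
      using insert.IH[OF indep] insert.hyps by (simp add: card_image card_cartesian_product)
  qed simp
qed

lemma card_subspace:
  fixes s :: "'k::{field,finite} \<Rightarrow> 'v::ab_group_add \<Rightarrow> 'v"
  assumes "vector_space s" "module.subspace s V" "finite V"
  shows "card V = CARD('k) ^ vector_space.dim s V"
proof -
  interpret vector_space s by fact
  obtain B where B: "B \<subseteq> V" "independent B" "V \<subseteq> span B" "card B = dim V"
    using basis_exists by blast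
  have "span B = V" using B assms(2) span_minimal by blast
  moreover have "finite B" using B(1) assms(3) finite_subset by blast
  ultimately show ?thesis
    using card_span_independent[OF assms(1) _ B(2)] B(4) by simp
qed

locale finite_extension =
  fixes \<iota> :: "'k::{field,finite} \<Rightarrow> 'a::{field,finite}" and q :: nat
  assumes embedding: "field_embedding \<iota>" and card_k: "CARD('k) = q"
begin

lemma \<iota>_simps [simp]:
  "\<iota> 1 = 1" "\<iota> (x + y) = \<iota> x + \<iota> y" "\<iota> (x * y) = \<iota> x * \<iota> y"
  using embedding by (auto simp: field_embedding_def)

lemma \<iota>_0 [simp]: "\<iota> 0 = 0"
  using \<iota>_simps(2)[of 0 0] by (simp only: add_0_left add_cancel_right_right)

lemma \<iota>_minus [simp]: "\<iota> (- x) = - \<iota> x"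
  using \<iota>_simps(2)[of x "- x"] by (simp add: minus_unique)

lemma \<iota>_diff [simp]: "\<iota> (x - y) = \<iota> x - \<iota> y"
  using \<iota>_simps(2)[of x "- y"] by simp

lemma \<iota>_eq_0_iff [simp]: "\<iota> x = 0 \<longleftrightarrow> x = 0"
proof
  assume "\<iota> x = 0"
  show "x = 0"
  proof (rule ccontr)
    assume "x \<noteq> 0"
    then have "\<iota> x * \<iota> (inverse x) = 1" by (simp flip: \<iota>_simps)
    with \<open>\<iota> x = 0\<close> show False by simp
  qed
qed simp

lemma inj_\<iota>: "inj \<iota>"
  by (rule injI) (metis \<iota>_diff \<iota>_eq_0_iff right_minus_eq)

lemma \<iota>_inverse [simp]: "\<iota> (inverse x) = inverse (\<iota> x)"
proof (cases "x = 0")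
  case False
  then have "\<iota> x * \<iota> (inverse x) = 1" by (simp flip: \<iota>_simps)
  then show ?thesis by (metis inverse_unique)
qed simp

lemma \<iota>_power [simp]: "\<iota> (x ^ k) = \<iota> x ^ k"
  by (induction k) auto

lemma \<iota>_of_nat [simp]: "\<iota> (of_nat k) = of_nat k"
  by (induction k) auto

sublocale vector_space "ext_scale \<iota>"
  by (rule vector_space_ext_scale[OF embedding])

lemma q_ge_2: "q \<ge> 2"
proof -
  have "card {0 :: 'k, 1} \<le> CARD('k)" by (rule card_mono) auto
  then show ?thesis by (simp add: card_k)
qed

section \<open>Powers of Frobenius and the elements they fix\<close>

lemma \<iota>_power_q [simp]: "\<iota> c ^ q ^ k = \<iota> c"
proof (induction k)
  case (Suc k)
  have "\<iota> c ^ q ^ Suc k = (\<iota> c ^ q ^ k) ^ q" by (simp only: power_Suc2 power_mult)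
  also have "\<dots> = \<iota> (c ^ CARD('k))" by (simp add: Suc.IH card_k)
  finally show ?case by (simp only: finite_field_power_CARD)
qed simp

text \<open>Counts roots of \<open>X ^ q ^ k - X\<close>, which is nonzero because
  \<open>k > 0\<close> makes \<open>q ^ k > 1\<close>.\<close>

lemma card_fixed_le:
  assumes "k > 0"
  shows "card {x :: 'a. x ^ q ^ k = x} \<le> q ^ k"
proof -
  define p :: "'a poly" where "p = monom 1 (q ^ k) - [:0, 1:]"
  have gt: "q ^ k > 1" using q_ge_2 assms by (intro one_less_power) auto
  have roots: "{x. poly p x = 0} = {x. x ^ q ^ k = x}"
    by (auto simp: p_def poly_monom)
  have "coeff p (q ^ k) = 1"
    using gt assms by (auto simp: p_def coeff_pCons split: nat.split)
  then have "p \<noteq> 0" by auto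
  moreover have "degree p \<le> q ^ k"
    unfolding p_def using gt by (intro degree_diff_le) (auto simp: degree_monom_le)
  ultimately show ?thesis
    using card_poly_roots_bound[of p] roots by simp
qed

text \<open>The range already supplies \<open>q\<close> roots of \<open>X ^ q - X\<close>, the most
  that are possible.\<close>

lemma range_\<iota>_iff: "x \<in> range \<iota> \<longleftrightarrow> x ^ q = x"
proof -
  have "card {x :: 'a. x ^ q = x} \<le> card (range \<iota>)"
    using card_fixed_le[of 1] inj_\<iota> by (simp add: card_image card_k)
  then have "range \<iota> = {x. x ^ q = x}"
    using \<iota>_power_q[of _ 1] by (intro card_seteq) auto
  then show ?thesis by auto
qed

text \<open>
  The polynomial \<open>(X + 1) ^ q - X ^ q - 1\<close> over the small field has degree less than \<open>q\<close> and vanishes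
  at all \<open>q\<close> elements, so its coefficients are zero.
\<close>

lemma of_nat_binomial_q:
  assumes "0 < k" "k < q"
  shows "(of_nat (q choose k) :: 'k) = 0"
proof -
  define p :: "'k poly" where "p = (\<Sum>k\<in>{0<..<q}. monom (of_nat (q choose k)) k)"
  have "p = 0"
  proof (rule poly_eqI_degree[of UNIV])
    fix x :: 'k
    have split: "{..q} = insert 0 (insert q {0<..<q})" using q_ge_2 by auto
    have "x + 1 = (x + 1) ^ q" using finite_field_power_CARD[of "x + 1"] by (simp add: card_k)
    also have "\<dots> = (\<Sum>k\<le>q. of_nat (q choose k) * x ^ k)"
      by (simp add: binomial_ring)
    also have "\<dots> = 1 + (x ^ q + poly p x)"
      using q_ge_2 by (simp add: split p_def poly_sum poly_monom)
    also have "x ^ q = x" using finite_field_power_CARD[of x] by (simp add: card_k)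
    finally show "poly p x = poly 0 x" by simp
  next
    have "degree p \<le> q - 1"
      unfolding p_def by (intro degree_sum_le) (auto intro: order_trans[OF degree_monom_le])
    then show "degree p < CARD('k)" using q_ge_2 by (simp add: card_k)
  qed (use q_ge_2 card_k in auto)
  then have "coeff p k = 0" by simp
  also have "coeff p k = of_nat (q choose k)"
    using assms by (simp add: p_def coeff_sum)
  finally show ?thesis .
qed

text \<open>The inner binomial coefficients vanish in the small field, and \<iota> carries this to
  the large one. Iterating gives all \<open>k\<close>.\<close>

lemma frobenius_add: "(x + y :: 'a) ^ q ^ k = x ^ q ^ k + y ^ q ^ k"
proof (induction k)
  case (Suc k)
  have add: "(a + b :: 'a) ^ q = a ^ q + b ^ q" for a b
  proof -
    have split: "{..q} = insert 0 (insert q {0<..<q})" using q_ge_2 by auto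
    have "of_nat (q choose i) = (0 :: 'a)" if "0 < i" "i < q" for i
      using of_nat_binomial_q[OF that] \<iota>_of_nat[of "q choose i"] by simp
    then have "(\<Sum>i\<in>{0<..<q}. of_nat (q choose i) * a ^ i * b ^ (q - i)) = 0"
      by (intro sum.neutral) auto
    then show ?thesis
      using q_ge_2 by (simp add: binomial_ring split)
  qed
  have "(x + y) ^ q ^ Suc k = ((x + y) ^ q ^ k) ^ q" by (simp only: power_Suc2 power_mult)
  also have "\<dots> = (x ^ q ^ k) ^ q + (y ^ q ^ k) ^ q" by (simp only: Suc.IH add)
  also have "\<dots> = x ^ q ^ Suc k + y ^ q ^ Suc k"
    by (simp only: power_Suc2 power_mult)
  finally show ?case .
qed simp

lemma frobenius_diff: "(x - y :: 'a) ^ q ^ k = x ^ q ^ k - y ^ q ^ k"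
  using frobenius_add[of "x - y" y k] by simp

lemma inj_frobenius:
  assumes "(x :: 'a) ^ q ^ k = y ^ q ^ k"
  shows "x = y"
  using frobenius_diff[of x y k] assms by simp

lemma power_q_iterate:
  assumes "(x :: 'a) ^ q ^ a = x"
  shows "x ^ q ^ (a * b) = x"
proof (induction b)
  case (Suc b)
  have "x ^ q ^ (a * Suc b) = (x ^ q ^ a) ^ q ^ (a * b)" by (simp add: power_add power_mult)
  then show ?case by (simp add: assms Suc.IH)
qed simp

text \<open>Bezout in the form \<open>a * u = b * v + gcd a b\<close> avoids negative exponents, but
  requires \<open>a \<noteq> 0\<close>.\<close>

lemma power_q_gcd:
  assumes a: "(x :: 'a) ^ q ^ a = x" and b: "x ^ q ^ b = x"
  shows "x ^ q ^ gcd a b = x"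
proof (cases "a = 0")
  case True
  then show ?thesis using b by simp
next
  case False
  then obtain u v where uv: "a * u = b * v + gcd a b"
    using bezout_nat[of a b] by auto
  have "x = x ^ q ^ (a * u)" using power_q_iterate[OF a] by simp
  also have "\<dots> = (x ^ q ^ (b * v)) ^ q ^ gcd a b" by (simp add: uv power_add power_mult)
  finally show ?thesis by (simp add: power_q_iterate[OF b])
qed

lemma subfield_fixed: "is_subfield {x :: 'a. x ^ q ^ k = x}"
  using q_ge_2 by (auto simp: is_subfield_def frobenius_diff power_mult_distrib power_inverse)


section \<open>Points and lines over the extension\<close>

lemma pg_point_scale:
  assumes "c \<noteq> 0"
  shows "pg_point (ext_scale \<iota>) (\<iota> c * y) = pg_point (ext_scale \<iota>) y"
  unfolding pg_point_def
proof (rule span_eq[THEN iffD2], intro conjI; clarsimp)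
  show "\<iota> c * y \<in> span {y}"
    using span_scale[OF span_base[of y "{y}"], of c] by (simp add: ext_scale_def)
  have "ext_scale \<iota> (inverse c) (\<iota> c * y) = y"
    using assms by (simp add: ext_scale_def)
  then show "y \<in> span {\<iota> c * y}"
    using span_scale[OF span_base[of "\<iota> c * y" "{\<iota> c * y}"], of "inverse c"] by simp
qed

text \<open>Changing the exponent by a multiple of \<open>M\<close> contributes only a ground field
  factor.\<close>

lemma pg_point_power_cong:
  assumes z: "z \<noteq> 0" "z ^ M \<in> range \<iota>" and cong: "[e1 = e2] (mod M)"
  shows "pg_point (ext_scale \<iota>) (b * z ^ e1) = pg_point (ext_scale \<iota>) (b * z ^ e2)"
proof -
  have *: "pg_point (ext_scale \<iota>) (b * z ^ e1) = pg_point (ext_scale \<iota>) (b * z ^ e2)"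
    if le: "e1 \<le> e2" and cong: "[e1 = e2] (mod M)" for e1 e2
  proof -
    obtain k where k: "e2 = e1 + M * k"
      using cong_le_nat[OF le, of M] cong by (auto simp: cong_sym_eq mult.commute add.commute)
    obtain c where c: "z ^ M = \<iota> c" using z(2) by auto
    then have "c \<noteq> 0" using z(1) by auto
    moreover have "b * z ^ e2 = \<iota> (c ^ k) * (b * z ^ e1)"
      by (simp add: k power_add power_mult c)
    ultimately show ?thesis by (simp only: pg_point_scale power_not_zero not_False_eq_True)
  qed
  show ?thesis
    using *[OF _ cong] *[OF _ cong_sym[OF cong], symmetric] linear[of e1 e2] by (elim disjE)
qed

text \<open>The power is the product of the conjugates \<open>z ^ q ^ i\<close>, a norm. Raising it
  to the power \<open>q\<close> permutes the factors cyclically, so \<open>range_\<iota>_iff\<close>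
  applies.\<close>

lemma power_sum_powers_in_range:
  assumes "(z :: 'a) ^ q ^ m = z"
  shows "z ^ (\<Sum>i<m. q ^ i) \<in> range \<iota>"
proof -
  define T where "T = (\<Sum>i<m. q ^ i)"
  have "T + q ^ m = 1 + q * T"
    using sum.lessThan_Suc_shift[of "\<lambda>i. q ^ i" m]
    by (simp add: T_def sum_distrib_left)
  then have "z ^ (T + q ^ m) = z ^ (1 + q * T)" by simp
  then have "z * z ^ T = z * (z ^ T) ^ q"
    using assms by (simp add: power_add power_mult mult.commute)
  then have "(z ^ T) ^ q = z ^ T" if "z \<noteq> 0" using that by simp
  \<comment> \<open>The cancellation above fails at zero; the value 1 covers the empty sum
    \<open>T = 0\<close>.\<close>
  moreover have "(0 :: 'a) ^ T = 0 \<or> (0 :: 'a) ^ T = 1" by (cases "T = 0") auto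
  then have "((0 :: 'a) ^ T) ^ q = 0 ^ T" using q_ge_2 by (elim disjE) (simp_all only: power_one, simp)
  ultimately show ?thesis unfolding range_\<iota>_iff T_def[symmetric] by (cases "z = 0") auto
qed

lemma pg_point_in_pg_points_iff:
  assumes "subspace V" "z \<noteq> 0"
  shows "pg_point (ext_scale \<iota>) z \<in> pg_points (ext_scale \<iota>) V \<longleftrightarrow> z \<in> V"
proof
  assume "pg_point (ext_scale \<iota>) z \<in> pg_points (ext_scale \<iota>) V"
  then obtain y where "y \<in> V" "span {z} = span {y}"
    by (auto simp: pg_points_def pg_point_def)
  then show "z \<in> V"
    using span_base[of z "{z}"] span_minimal[of "{y}" V] assms(1) by blast
qed (use assms(2) in \<open>auto simp: pg_points_def\<close>)

text \<open>Take a basis \<open>x\<close>, \<open>y\<close> and put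
  \<open>w = y / x\<close>.\<close>

lemma line_param:
  assumes "pg_line (ext_scale \<iota>) l"
  obtains x w where "x \<noteq> 0" "\<Union>l = {(\<iota> \<alpha> + \<iota> \<beta> * w) * x | \<alpha> \<beta>. True}"
    "subspace (\<Union>l)" "l = pg_points (ext_scale \<iota>) (\<Union>l)"
proof -
  obtain V where V: "subspace V" "dim V = 2" "l = pg_points (ext_scale \<iota>) V"
    using assms by (auto simp: pg_line_def pg_subspace_def)
  obtain B where B: "B \<subseteq> V" "independent B" "V \<subseteq> span B" "card B = 2"
    using basis_exists[of V] V(2) by metis
  then obtain x y where xy: "B = {x, y}" "x \<noteq> y" by (auto simp: card_2_iff)
  have x: "x \<noteq> 0" using B(2) xy dependent_zero by blast
  have "V = span {x, y}" using B V(1) xy span_minimal by blast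
  also have "\<dots> = {(\<iota> \<alpha> + \<iota> \<beta> * (y / x)) * x | \<alpha> \<beta>. True}"
  proof -
    have "z - \<iota> \<alpha> * x = \<iota> \<beta> * y \<longleftrightarrow> z = (\<iota> \<alpha> + \<iota> \<beta> * (y / x)) * x" for z \<alpha> \<beta>
      using x by (auto simp: diff_eq_eq distrib_right add.commute)
    then show ?thesis
      unfolding span_insert[of x] span_singleton ext_scale_def image_def by auto
  qed
  finally have V_eq: "V = {(\<iota> \<alpha> + \<iota> \<beta> * (y / x)) * x | \<alpha> \<beta>. True}" .
  have "V \<noteq> {0}" using B(1) xy(1) x by auto
  then have "\<Union>l = V"
    using Union_pg_points[OF vector_space_axioms V(1)] V(3) by simp
  then show ?thesis
    by (intro that[OF x, of "y / x"]) (simp_all only: V_eq[symmetric] V(1) V(3)[symmetric])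
qed

text \<open>The minimum is attained, since \<open>t\<close> qualifies with the whole field as
  \<open>L\<close>.\<close>

lemma line_order_exists:
  fixes l :: "'a set set"
  assumes "CARD('a) = q ^ t" "t > 0"
  obtains L a where "line_order q l > 0" "is_subfield L" "card L = q ^ line_order q l"
    "a \<noteq> 0" "\<Union>l \<subseteq> {c * a | c. c \<in> L}"
proof -
  have "\<exists>m. m > 0 \<and> (\<exists>L :: 'a set. is_subfield L \<and> card L = q ^ m \<and>
      (\<exists>a. a \<noteq> 0 \<and> \<Union>l \<subseteq> {c * a | c. c \<in> L}))"
    using assms by (intro exI[of _ t] conjI exI[of _ UNIV] exI[of _ 1]) (auto simp: is_subfield_def)
  from LeastI_ex[OF this] show ?thesis
    using that unfolding line_order_def[symmetric] by auto
qed

text \<open>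
  If \<open>w\<close> had a conjugate equal to itself too early, the field fixed by that power of Frobenius would
  contradict the minimality of \<open>line_order\<close>.
\<close>

lemma conjugates_distinct:
  fixes l :: "'a set set"
  assumes card_a: "CARD('a) = q ^ t" and cop: "gcd \<nu> t = 1"
    and l: "x \<noteq> 0" "\<Union>l = {(\<iota> \<alpha> + \<iota> \<beta> * w) * x | \<alpha> \<beta>. True}"
    and r: "0 < r" "r < line_order q l"
  shows "w ^ q ^ (\<nu> * r) \<noteq> w"
proof
  assume w: "w ^ q ^ (\<nu> * r) = w"
  define g where "g = gcd (\<nu> * r) t"
  \<comment> \<open>As \<nu> is coprime to \<open>t\<close>, it cancels, which bounds
    \<open>g\<close> by \<open>r\<close> rather than by \<open>\<nu> * r\<close>.\<close>
  have "g = gcd r t"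
    unfolding g_def using cop
    by (intro gcd_mult_left_left_cancel) (simp add: coprime_iff_gcd_eq_1 gcd.commute)
  then have g: "0 < g" "g \<le> r" using r by (auto intro: gcd_le1_nat)
  define L where "L = {z :: 'a. z ^ q ^ g = z}"
  have L: "is_subfield L" unfolding L_def by (rule subfield_fixed)
  \<comment> \<open>Being a ground field subspace, \<open>L\<close> has order a power of
    \<open>q\<close>. Bounding the exponent by \<open>g\<close> suffices to contradict
    minimality.\<close>
  have "subspace L"
    unfolding L_def by (rule subspaceI)
      (use q_ge_2 in \<open>auto simp: frobenius_add ext_scale_def power_mult_distrib\<close>)
  then have card_L: "card L = q ^ dim L"
    using card_subspace[OF vector_space_axioms] by (simp add: card_k)
  have "q ^ dim L \<le> q ^ g"
    using card_fixed_le[OF g(1)] unfolding L_def[symmetric] card_L .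
  then have "dim L \<le> g"
    by (rule power_le_imp_le_exp[rotated]) (use q_ge_2 in simp)
  have "dim L \<noteq> 0"
  proof
    assume "dim L = 0"
    then have "card L = 1" using card_L by simp
    moreover have "{0, 1} \<subseteq> L" using L by (auto simp: is_subfield_def)
    then have "card {0 :: 'a, 1} \<le> card L" by (intro card_mono) auto
    ultimately show False by simp
  qed
  have "w ^ q ^ t = w" using finite_field_power_CARD[of w] by (simp add: card_a)
  then have "w ^ q ^ g = w" unfolding g_def by (rule power_q_gcd[OF w])
  then have "\<Union>l \<subseteq> {c * x | c. c \<in> L}"
    unfolding l(2) by (fastforce simp: L_def frobenius_add power_mult_distrib)
  then have "line_order q l \<le> dim L"
    unfolding line_order_def using \<open>dim L \<noteq> 0\<close> L card_L l(1) by (intro Least_le) blast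
  with \<open>dim L \<le> g\<close> g r show False by simp
qed

end

section \<open>Images of the standard normal rational curve\<close>

lemma card_coord_space:
  "finite (coord_space n :: (nat \<Rightarrow> 'k::{field,finite}) set)"
  "card (coord_space n :: (nat \<Rightarrow> 'k::{field,finite}) set) = CARD('k) ^ (n + 1)"
proof -
  have bij: "bij_betw (\<lambda>v. restrict v {..n}) (coord_space n) ({..n} \<rightarrow>\<^sub>E (UNIV :: 'k set))"
    by (rule bij_betw_byWitness[where f' = "\<lambda>u i. if i \<le> n then u i else 0"])
      (auto simp: coord_space_def restrict_def fun_eq_iff PiE_def extensional_def)
  then show "finite (coord_space n :: (nat \<Rightarrow> 'k) set)"
    using bij_betw_finite finite_PiE[of "{..n}" "\<lambda>_. UNIV :: 'k set"] by auto
  show "card (coord_space n :: (nat \<Rightarrow> 'k) set) = CARD('k) ^ (n + 1)"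
    using bij_betw_same_card[OF bij] by (simp add: card_PiE)
qed

text \<open>Points are spans, so \<open>f\<close> acts on them by direct image. The dimension of the
  image is read off from its cardinality.\<close>

lemma normal_rational_curve_linear_image:
  fixes s :: "'k::{field,finite} \<Rightarrow> 'v::ab_group_add \<Rightarrow> 'v"
  assumes lin: "Vector_Spaces.linear coord_scale s f" and inj: "inj_on f (coord_space n)"
  defines "B \<equiv> pg_points s (f ` coord_space n)"
  shows "pg_subspace s n B" "normal_rational_curve s n B ((`) f ` standard_nrc n)"
proof -
  interpret f: Vector_Spaces.linear coord_scale s f by fact
  have sub: "f.vs1.subspace (coord_space n)"
    by (rule f.vs1.subspaceI) (auto simp: coord_space_def coord_scale_def)
  then have sub': "f.vs2.subspace (f ` coord_space n)" by (rule f.subspace_image)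
  have "CARD('k) ^ f.vs2.dim (f ` coord_space n) = CARD('k) ^ (n + 1)"
    using card_subspace[OF f.vs2.vector_space_axioms sub'] card_coord_space[where ?'k = 'k]
    by (simp add: card_image[OF inj])
  moreover have "CARD('k) > 1"
    using card_mono[of "UNIV :: 'k set" "{0, 1}"] by simp
  ultimately have dim: "f.vs2.dim (f ` coord_space n) = n + 1"
    by (simp only: power_inject_exp)
  then show B: "pg_subspace s n B"
    unfolding pg_subspace_def B_def using sub' by blast
  \<comment> \<open>A nonzero vector, to exclude the zero space, which has no points and so is not
    their union.\<close>
  define e :: "nat \<Rightarrow> 'k" where "e = (\<lambda>i. if i = 0 then 1 else 0)"
  have e: "e \<in> coord_space n" "e \<noteq> 0"
    by (auto simp: e_def coord_space_def fun_eq_iff)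
  have "f e \<noteq> 0"
    using inj_onD[OF inj, of e 0] e f.vs1.subspace_0[OF sub] f.zero by auto
  then have "f ` coord_space n \<noteq> {0}" using e by blast
  then have Un2: "\<Union>B = f ` coord_space n"
    unfolding B_def by (intro Union_pg_points f.vs2.vector_space_axioms sub')
  have "coord_space n \<noteq> {0 :: nat \<Rightarrow> 'k}" using e by blast
  then have Un1: "\<Union>(PG n) = (coord_space n :: (nat \<Rightarrow> 'k) set)"
    unfolding PG_def by (intro Union_pg_points f.vs1.vector_space_axioms sub)
  have "projectivity coord_scale (PG n) s B ((`) f)"
    unfolding projectivity_def Un1 Un2
    using lin inj by (intro exI[of _ f]) (auto simp: bij_betw_def pg_point_def f.span_image[symmetric])
  then show "normal_rational_curve s n B ((`) f ` standard_nrc n)"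
    unfolding normal_rational_curve_def using B by blast
qed


section \<open>The power of a line\<close>

theorem theorem5p10:
  fixes \<iota> :: "'k::{field,finite} \<Rightarrow> 'a::{field,finite}"
    and l :: "'a set set"
    and q t m \<nu> h n d \<nu>inv \<theta>inv :: nat
  assumes "field_embedding \<iota>"
    and "CARD('k) = q"
    and "CARD('a) = q ^ t"
    and "pg_line (ext_scale \<iota>) l"
    and "line_order q l = m"
    and "\<nu> \<in> {1..t - 1}"
    and "h \<in> {1..t - 1}"
    and "gcd \<nu> t = 1"
    and "\<not> m dvd h"
    and "[\<nu>inv * \<nu> = 1] (mod m)"
    and "1 \<le> n" and "n \<le> m - 1" and "[n = h * \<nu>inv] (mod m)"
    and "[\<theta>inv * theta q (\<nu> - 1) = 1] (mod theta q (t - 1))"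
    and "d = \<theta>inv * theta q (h - 1)"
    and "q \<ge> n"
  shows "\<exists>B. pg_subspace (ext_scale \<iota>) n B \<and>
             normal_rational_curve (ext_scale \<iota>) n B (power_image (ext_scale \<iota>) d l)"
proof -
  interpret finite_extension \<iota> q
    by unfold_locales fact+
  \<comment> \<open>\<open>T k\<close> is theta at \<open>k - 1\<close>, and \<open>N\<close> is the
    quotient of \<open>T (\<nu> * n)\<close> by \<open>T \<nu>\<close>.\<close>
  define T where "T k = (\<Sum>i<k. q ^ i)" for k
  define N where "N = (\<Sum>i<n. q ^ (\<nu> * i))"
  define s where "s = ext_scale \<iota>"
  have t: "t > 0" using assms(6) by auto
  obtain x w where x: "x \<noteq> 0" and Ul: "\<Union>l = {(\<iota> \<alpha> + \<iota> \<beta> * w) * x | \<alpha> \<beta>. True}"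
    and sub: "subspace (\<Union>l)" and l_eq: "l = pg_points (ext_scale \<iota>) (\<Union>l)"
    using line_param[OF assms(4)] by blast
  have in_l: "pg_point s z \<in> l \<longleftrightarrow> z \<in> \<Union>l" if "z \<noteq> 0" for z
    using pg_point_in_pg_points_iff[OF sub that] l_eq by (simp add: s_def)

  obtain L a where L: "is_subfield L" "card L = q ^ m" "a \<noteq> 0" "\<Union>l \<subseteq> {c * a | c. c \<in> L}"
    by (rule line_order_exists[OF assms(3) t, of l, unfolded assms(5)]) (rule that)
  \<comment> \<open>Both \<open>x\<close> and \<open>w * x\<close> are multiples of \<open>a\<close>
    by elements of \<open>L\<close>, and \<open>w\<close> is their quotient.\<close>
  have w_L: "w \<in> L"
  proof -
    have "x = (\<iota> 1 + \<iota> 0 * w) * x" "w * x = (\<iota> 0 + \<iota> 1 * w) * x" by simp_all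
    then have "x \<in> \<Union>l" "w * x \<in> \<Union>l" unfolding Ul by blast+
    from this[THEN subsetD[OF L(4)]]
    obtain c c' where c: "c \<in> L" "x = c * a" and c': "c' \<in> L" "w * x = c' * a"
      by (elim CollectE exE conjE)
    have "(w * c) * a = c' * a" using c(2) c'(2) by (simp add: mult.assoc)
    then have "w * c = c'" using L(3) by simp
    moreover have "c \<noteq> 0" using x c(2) by auto
    ultimately have "w = c' * inverse c" by auto
    then show ?thesis using c c' L(1) by (simp add: is_subfield_def)
  qed
  then have w_m: "w ^ q ^ m = w"
    using subfield_power_card[OF L(1) _ w_L] L(2) by simp

  \<comment> \<open>Two moduli are involved: \<open>T m\<close> allows replacing \<open>h\<close> by
    \<open>\<nu> * n\<close> for \<open>z\<close> fixed by the power \<open>q ^ m\<close>, while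
    \<open>\<theta>inv\<close> is cancelled modulo \<open>T t\<close>.\<close>
  have power_eq: "pg_point s (b * z ^ d) = pg_point s (b * z ^ N)"
    if z: "z \<noteq> 0" "z ^ q ^ m = z" for b z
  proof -
    have theta: "theta q (\<nu> - 1) = T \<nu>" "theta q (h - 1) = T h" "theta q (t - 1) = T t"
      unfolding T_def using assms(6,7) t q_ge_2
      by (auto intro!: theta_eq_sum_lessThan simp del: One_nat_def)
    have "[n * \<nu> = h * \<nu>inv * \<nu>] (mod m)" using assms(13) by (rule cong_scalar_right)
    also have "[h * \<nu>inv * \<nu> = h] (mod m)"
      using cong_scalar_left[OF assms(10), of h] by (simp add: mult.assoc)
    finally have "[T h = T (\<nu> * n)] (mod T m)"
      unfolding T_def by (intro cong_sum_powers) (simp add: cong_sym_eq mult.commute)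
    then have c1: "[d = \<theta>inv * T (\<nu> * n)] (mod T m)"
      unfolding assms(15) theta by (rule cong_scalar_left)
    have c2: "[\<theta>inv * T (\<nu> * n) = N] (mod T t)"
    proof -
      have "T (\<nu> * n) = T \<nu> * N" by (simp add: T_def N_def sum_powers_mult)
      then show ?thesis
        using cong_scalar_right[OF assms(14)[unfolded theta], of N] by (simp add: mult.assoc)
    qed
    have "z ^ q ^ t = z" using finite_field_power_CARD[of z] by (simp add: assms(3))
    then have "z ^ T m \<in> range \<iota>" "z ^ T t \<in> range \<iota>"
      using z(2) unfolding T_def by (simp_all only: power_sum_powers_in_range)
    then show ?thesis
      unfolding s_def using pg_point_power_cong[OF z(1) _ c1] pg_point_power_cong[OF z(1) _ c2]
      by (simp only:)
  qed

  define W where "W i = w ^ q ^ (\<nu> * i)" for i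
  define P where "P = (\<Prod>i<n. [:- W i, 1:])"
  have P_monic: "degree P = n" "coeff P n = 1"
    unfolding P_def by (rule linear_factors_monic)+
  \<comment> \<open>Frobenius fixes \<open>\<iota> c\<close>, so the factors are the conjugates of
    \<open>\<iota> c - w\<close>.\<close>
  have poly_P: "poly P (\<iota> c) = (\<iota> c - w) ^ N" for c
    by (simp add: P_def N_def W_def poly_prod power_sum frobenius_diff)
  \<comment> \<open>Chosen so that the vector of powers of \<open>c\<close> goes to
    \<open>x ^ d\<close> times the value of \<open>P\<close> at \<open>c\<close>.\<close>
  define f where "f v = x ^ d * (\<Sum>k\<le>n. \<iota> (v k) * coeff P k)" for v
  have lin: "Vector_Spaces.linear coord_scale s f"
    unfolding s_def Vector_Spaces.linear_iff
    by (intro conjI allI vector_space_coord_scale vector_space_axioms)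
      (simp_all add: f_def coord_scale_def ext_scale_def distrib_left distrib_right
        sum.distrib sum_distrib_left mult_ac)
  have inj: "inj_on f (coord_space n)"
  proof (rule inj_onI)
    fix u v :: "nat \<Rightarrow> 'k"
    assume uv: "u \<in> coord_space n" "v \<in> coord_space n" "f u = f v"
    define c where "c k = \<iota> (u k - v k)" for k
    have c0: "(\<Sum>k\<le>n. c k * coeff P k) = 0"
      using uv(3) x by (simp add: f_def c_def algebra_simps sum_subtractf)
    have "c k = 0" if "k \<le> n" for k
    proof (rule functional_vanishes_if_consecutive[OF _ _ that])
      fix j r assume r: "0 < r" "r \<le> n"
      have "W r \<noteq> w"
        unfolding W_def using conjugates_distinct[OF assms(3,8) x Ul, of r] r assms(5,11,12) by simp
      moreover have "W (j + r) = W r ^ q ^ (\<nu> * j)"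
        by (simp add: W_def distrib_left power_add power_mult[symmetric] mult.commute)
      ultimately show "W (j + r) \<noteq> W j"
        using inj_frobenius[of "W r" "\<nu> * j" w] by (auto simp: W_def)
    next
      fix j
      \<comment> \<open>This conjugation fixes every \<open>c k\<close> and shifts the roots
        \<open>W i\<close> by \<open>j\<close>, so it carries the relation \<open>c0\<close> to the
        shifted product.\<close>
      define g where "g y = y ^ q ^ (\<nu> * j)" for y :: 'a
      have g: "g (y + z) = g y + g z" "g (y * z) = g y * g z" "g 1 = 1" "g (c k) = c k"
        for y z k
        by (simp_all only: g_def frobenius_add power_mult_distrib power_one c_def \<iota>_power_q)
      have W: "W (j + i) = g (W i)" for i
        by (simp add: W_def g_def distrib_left power_add power_mult[symmetric] mult.commute)
      have g0: "g 0 = 0" using q_ge_2 by (simp add: g_def)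
      have g_sum: "g (sum F A) = (\<Sum>k\<in>A. g (F k))" if "finite A" for F and A :: "nat set"
        using that by induction (auto simp: g g0)
      have "(\<Sum>k\<le>n. c k * coeff (\<Prod>i<n. [:- W (j + i), 1:]) k) = g (\<Sum>k\<le>n. c k * coeff P k)"
        unfolding W P_def by (simp add: coeff_linear_factors_hom g g_sum)
      then show "(\<Sum>k\<le>n. c k * coeff (\<Prod>i<n. [:- W (j + i), 1:]) k) = 0"
        by (simp add: c0 g0)
    qed
    then have "u k = v k" for k
      using uv by (cases "k \<le> n") (auto simp: c_def coord_space_def dest: injD[OF inj_\<iota>])
    then show "u = v" by blast
  qed

  define A where "A c = (\<lambda>i. if i \<le> n then c ^ i else 0)" for c :: 'k
  define E where "E = (\<lambda>i. if i = n then 1 else 0 :: 'k)"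
  have fA: "f (A c) = x ^ d * (\<iota> c - w) ^ N" for c
  proof -
    have "(\<Sum>k\<le>n. \<iota> (A c k) * coeff P k) = poly P (\<iota> c)"
      unfolding poly_altdef P_monic by (rule sum.cong) (auto simp: A_def mult.commute)
    then show ?thesis by (simp only: f_def poly_P)
  qed
  \<comment> \<open>Only the leading coefficient of the monic \<open>P\<close> survives.\<close>
  have fE: "f E = x ^ d"
  proof -
    have "(\<Sum>k\<le>n. \<iota> (E k) * coeff P k) = (\<Sum>k\<le>n. if k = n then 1 else 0)"
      using P_monic(2) by (intro sum.cong) (auto simp: E_def)
    then show ?thesis by (simp add: f_def)
  qed
  have image: "f ` pg_point coord_scale v = pg_point s (f v)" for v
    unfolding pg_point_def
    using module_hom.span_image[OF Vector_Spaces.linear.axioms(3)[OF lin], of "{v}"] by simp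
  have "1 < line_order q l" using assms(5,11,12) by linarith
  \<comment> \<open>An element of the ground field would equal its first conjugate, although
    \<open>1 < m\<close>. Thus \<open>\<iota> c - w\<close> never vanishes.\<close>
  then have w_range: "\<iota> c \<noteq> w" for c
    using conjugates_distinct[OF assms(3,8) x Ul, of 1] \<iota>_power_q[of c "\<nu>"] by auto
  have finite_pt: "pg_point s ((x * (\<iota> c - w)) ^ d) = pg_point s (f (A c))" for c
    using power_eq[of "\<iota> c - w" "x ^ d"] w_range
    by (simp add: fA power_mult_distrib frobenius_diff w_m)
  have "power_image s d l = (`) f ` standard_nrc n"
  proof (intro equalityI subsetI)
    fix p assume "p \<in> power_image s d l"
    then obtain z where z: "p = pg_point s (z ^ d)" "z \<noteq> 0" "z \<in> \<Union>l"
      using in_l by (auto simp: power_image_def)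
    then obtain \<alpha> \<beta> where z_eq: "z = (\<iota> \<alpha> + \<iota> \<beta> * w) * x" unfolding Ul by blast
    show "p \<in> (`) f ` standard_nrc n"
    proof (cases "\<beta> = 0")
      \<comment> \<open>The point of \<open>x\<close> itself, which corresponds to the parameter at
        infinity.\<close>
      case True
      then have "\<alpha> \<noteq> 0" "z ^ d = \<iota> (\<alpha> ^ d) * x ^ d"
        using z(2) z_eq by (auto simp: power_mult_distrib)
      then have "p = f ` pg_point coord_scale E"
        unfolding z(1) image fE s_def by (simp only: pg_point_scale power_not_zero not_False_eq_True)
      then show ?thesis unfolding standard_nrc_def E_def by blast
    next
      case False
      \<comment> \<open>Normalises the coefficient of \<open>w\<close> to -1, leaving the ground
        field factor \<open>- \<beta>\<close>.\<close>
      define c where "c = - (\<alpha> * inverse \<beta>)"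
      have "z = \<iota> (- \<beta>) * (x * (\<iota> c - w))"
        using False by (simp add: z_eq c_def algebra_simps)
      then have "z ^ d = \<iota> ((- \<beta>) ^ d) * (x * (\<iota> c - w)) ^ d"
        by (simp only: power_mult_distrib \<iota>_power)
      moreover have "(- \<beta>) ^ d \<noteq> 0" using False by simp
      ultimately have "p = pg_point s ((x * (\<iota> c - w)) ^ d)"
        unfolding z(1) s_def by (simp only: pg_point_scale not_False_eq_True)
      then have "p = f ` pg_point coord_scale (A c)"
        by (simp only: finite_pt image)
      then show ?thesis unfolding standard_nrc_def A_def by blast
    qed
  next
    fix p assume "p \<in> (`) f ` standard_nrc n"
    then consider c where "p = f ` pg_point coord_scale (A c)" | "p = f ` pg_point coord_scale E"
      unfolding standard_nrc_def A_def E_def by blast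
    then obtain z where "p = pg_point s (z ^ d)" "z \<noteq> 0" "z \<in> \<Union>l"
    proof cases
      case (1 c)
      have "x * (\<iota> c - w) = (\<iota> c + \<iota> (- 1) * w) * x" by (simp add: algebra_simps)
      then have "x * (\<iota> c - w) \<in> \<Union>l" unfolding Ul by blast
      then show ?thesis
        using that[of "x * (\<iota> c - w)"] 1 x w_range[of c] by (simp add: image finite_pt)
    next
      case 2
      have "x = (\<iota> 1 + \<iota> 0 * w) * x" by simp
      then have "x \<in> \<Union>l" unfolding Ul by blast
      then show ?thesis using that[of x] 2 x by (simp add: image fE)
    qed
    then show "p \<in> power_image s d l" using in_l by (auto simp: power_image_def)
  qed
  then show ?thesis
    using normal_rational_curve_linear_image[OF lin inj] unfolding s_def by metis
qed

end
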